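(* Let $G$ be a three-dimensional Lie group with a bi-invariant metric $\langle\,,\rangle$ and Lie algebra $\mathfrak{g}$. Let $\alpha:I\subset\mathbb{R}\to G$ be an arc-length parametrized regular curve with Frenet frame $\{T,N,B\}$, and let $\beta$ be the tangent indicatrix of $\alpha$, a curve on the unit sphere $S^2\subset\mathfrak{g}$. Then $\alpha$ is a slant helix in $G$ if and only if $\beta$ is a general helix on $S^2$.
   Context: $\mathfrak{g}$ is the Lie algebra of left-invariant vector fields of $G$ and $D$ is the Levi-Civita connection, so $D_XY=\frac12[X,Y]$ for $X,Y\in\mathfrak{g}$. Let $\{X_1,X_2,X_3\}$ be an orthonormal basis of $\mathfrak{g}$. Vector fields along $\alpha$ are written $W=\sum_i w_iX_i$ with smooth $w_i:I\to\mathbb{R}$; one sets $\dot W=\sum_i w_i'X_i$, brackets are extended bilinearly over functions, and $D_{\alpha'}W=\dot W+\frac12[T,W]$ with $T=\alpha'$. The Frenet apparatus of a unit speed curve consists of the positively oriented orthonormal frame $T=\alpha',N,B=T\times N$, the curvature $\varkappa=\|\dot T\|>0$ and the torsion $\tau$, with $D_TT=\varkappa N$, $D_TN=-\varkappa T+\tau B$, $D_TB=-\tau N$. Slant helix: $\alpha$ is a slant helix if there is a unit length left-invariant vector field $X\in\mathfrak{g}$ and a constant angle $\theta\ne\frac{\pi}{2}$ such that $\langle N(s),X\rangle=\cos\theta$ for all $s\in I$. Tangent indicatrix: writing $T(s)=\sum_{i=1}^3t_i(s)X_i$, it is the parametrized curve $\beta$ in $S^2\subset\mathfrak{g}$ given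 by $\beta(s^* )=T(s)=\sum_{i=1}^3t_i(s)X_i$, where $s^*$ is the arc length parameter of $\beta$. General helix: a curve whose unit tangent makes a constant angle with a left-invariant vector field, i.e. there are a unit length $X\in\mathfrak{g}$ and a constant $\theta$ with $\langle \text{unit tangent},X\rangle=\cos\theta$ along the curve; for the curve $\beta$ in the Euclidean space $\mathfrak{g}$ this means $\langle T_\beta(s^* ),X\rangle=\cos\theta$ for all $s^*$, where $T_\beta=d\beta/ds^*$.
   Formalization: The constant angle of a general helix is also required to differ from π/2, as for slant helices; otherwise a circular helix in Euclidean space, whose tangent indicatrix is a circle, would be a counterexample. *)

theory Defs
  imports "HOL-Analysis.Analysis" "HOL-Algebra.Group"
begin

section \<open>Smooth maps between manifolds\<close>

text \<open>
  Derivatives are taken within \<open>S\<close>, which is immaterial when \<open>S\<close> is open and gives one-sided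
  derivatives at the endpoints of an interval.
\<close>

primrec Ck_on ::
  "nat \<Rightarrow> ('a::real_normed_vector \<Rightarrow> 'b::real_normed_vector) \<Rightarrow> 'a set \<Rightarrow> bool" where
  "Ck_on 0 f S \<longleftrightarrow> continuous_on S f"
| "Ck_on (Suc k) f S \<longleftrightarrow>
     (\<exists>f'. (\<forall>x\<in>S. (f has_derivative f' x) (at x within S)) \<and> (\<forall>v. Ck_on k (\<lambda>x. f' x v) S))"

definition smooth_on :: "('a::real_normed_vector \<Rightarrow> 'b::real_normed_vector) \<Rightarrow> 'a set \<Rightarrow> bool" where
  "smooth_on f S \<longleftrightarrow> (\<forall>k. Ck_on k f S)"

text \<open>
  A manifold occupies a whole type. A chart is a pair of an open domain and a map that is a
  homeomorphism from it onto an open set of the model space; the model space is the type \<open>'e\<close>,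
  so that its dimension is the dimension of the manifold.
\<close>

type_synonym ('a, 'e) atlas = "('a set \<times> ('a \<Rightarrow> 'e)) set"

definition smooth_atlas ::
  "('a::{t2_space,second_countable_topology}, 'e::euclidean_space) atlas \<Rightarrow> bool" where
  "smooth_atlas A \<longleftrightarrow>
     (\<forall>(U, \<phi>)\<in>A. open U \<and> open (\<phi> ` U) \<and> (\<exists>\<psi>. homeomorphism U (\<phi> ` U) \<phi> \<psi>)) \<and>
     (\<Union>(U, \<phi>)\<in>A. U) = UNIV \<and>
     (\<forall>(U, \<phi>)\<in>A. \<forall>(V, \<psi>)\<in>A. smooth_on (\<psi> \<circ> inv_into U \<phi>) (\<phi> ` (U \<inter> V)))"

definition euclidean_atlas :: "('e::euclidean_space, 'e) atlas" where
  "euclidean_atlas = {(UNIV, id)}"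

definition product_atlas ::
  "('a, 'e) atlas \<Rightarrow> ('b, 'f) atlas \<Rightarrow> ('a \<times> 'b, 'e \<times> 'f) atlas" where
  "product_atlas A B = {(U \<times> V, map_prod \<phi> \<psi>) | U \<phi> V \<psi>. (U, \<phi>) \<in> A \<and> (V, \<psi>) \<in> B}"

definition smooth_map_on ::
  "'a::topological_space set \<Rightarrow> ('a, 'e::euclidean_space) atlas \<Rightarrow>
   ('b::topological_space, 'f::euclidean_space) atlas \<Rightarrow> ('a \<Rightarrow> 'b) \<Rightarrow> bool" where
  "smooth_map_on S A B f \<longleftrightarrow> continuous_on S f \<and>
     (\<forall>(U, \<phi>)\<in>A. \<forall>(V, \<psi>)\<in>B. smooth_on (\<psi> \<circ> f \<circ> inv_into U \<phi>) (\<phi> ` (S \<inter> U \<inter> f -` V)))"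

definition smooth_functions ::
  "('a::topological_space, 'e::euclidean_space) atlas \<Rightarrow> ('a \<Rightarrow> real) set" where
  "smooth_functions A = {f. smooth_map_on UNIV A euclidean_atlas f}"


section \<open>Tangent vectors, vector fields and Riemannian metrics\<close>

text \<open>
  Tangent vectors and vector fields are derivations of the algebra of smooth functions. They are
  extended by 0 to non-smooth functions, so that equal derivations are equal in HOL. The value of
  a vector field \<open>V\<close> at \<open>p\<close> is the tangent vector \<open>\<lambda>f. V f p\<close>.
\<close>

type_synonym 'a tvec = "('a \<Rightarrow> real) \<Rightarrow> real"
type_synonym 'a vfield = "('a \<Rightarrow> real) \<Rightarrow> ('a \<Rightarrow> real)"

definition tangent_space ::
  "('a::topological_space, 'e::euclidean_space) atlas \<Rightarrow> 'a \<Rightarrow> 'a tvec set" where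
  "tangent_space A p = {u.
     (\<forall>f. f \<notin> smooth_functions A \<longrightarrow> u f = 0) \<and>
     (\<forall>f\<in>smooth_functions A. \<forall>g\<in>smooth_functions A. \<forall>a b.
        u (\<lambda>x. a * f x + b * g x) = a * u f + b * u g \<and>
        u (\<lambda>x. f x * g x) = u f * g p + f p * u g)}"

definition vector_fields ::
  "('a::topological_space, 'e::euclidean_space) atlas \<Rightarrow> 'a vfield set" where
  "vector_fields A = {V.
     (\<forall>p. (\<lambda>f. V f p) \<in> tangent_space A p) \<and>
     (\<forall>f\<in>smooth_functions A. V f \<in> smooth_functions A)}"

definition bracket :: "'a vfield \<Rightarrow> 'a vfield \<Rightarrow> 'a vfield" where
  "bracket V W = (\<lambda>f p. V (W f) p - W (V f) p)"

definition riemannian_metric ::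
  "('a::topological_space, 'e::euclidean_space) atlas \<Rightarrow>
   ('a \<Rightarrow> 'a tvec \<Rightarrow> 'a tvec \<Rightarrow> real) \<Rightarrow> bool" where
  "riemannian_metric A m \<longleftrightarrow>
     (\<forall>p. \<forall>u\<in>tangent_space A p. \<forall>v\<in>tangent_space A p. \<forall>w\<in>tangent_space A p. \<forall>a b.
        m p u v = m p v u \<and>
        m p (\<lambda>f. a * u f + b * v f) w = a * m p u w + b * m p v w) \<and>
     (\<forall>p. \<forall>u\<in>tangent_space A p. u \<noteq> (\<lambda>f. 0) \<longrightarrow> m p u u > 0) \<and>
     (\<forall>V\<in>vector_fields A. \<forall>W\<in>vector_fields A.
        (\<lambda>p. m p (\<lambda>f. V f p) (\<lambda>f. W f p)) \<in> smooth_functions A)"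


section \<open>Lie groups with a bi-invariant metric\<close>

definition lie_group ::
  "'a::{t2_space,second_countable_topology} monoid \<Rightarrow> ('a, 'e::euclidean_space) atlas \<Rightarrow> bool" where
  "lie_group G A \<longleftrightarrow> group G \<and> carrier G = UNIV \<and> smooth_atlas A \<and>
     smooth_map_on UNIV (product_atlas A A) A (\<lambda>(x, y). x \<otimes>\<^bsub>G\<^esub> y) \<and>
     smooth_map_on UNIV A A (\<lambda>x. inv\<^bsub>G\<^esub> x)"

text \<open>The tangent map of \<open>\<phi>\<close> sends a derivation \<open>u\<close> to \<open>\<lambda>f. u (f \<circ> \<phi>)\<close>.\<close>

definition bi_invariant_metric ::
  "'a::{t2_space,second_countable_topology} monoid \<Rightarrow> ('a, 'e::euclidean_space) atlas \<Rightarrow>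
   ('a \<Rightarrow> 'a tvec \<Rightarrow> 'a tvec \<Rightarrow> real) \<Rightarrow> bool" where
  "bi_invariant_metric G A m \<longleftrightarrow> riemannian_metric A m \<and>
     (\<forall>g p. \<forall>u\<in>tangent_space A p. \<forall>v\<in>tangent_space A p.
        m (g \<otimes>\<^bsub>G\<^esub> p) (\<lambda>f. u (\<lambda>x. f (g \<otimes>\<^bsub>G\<^esub> x))) (\<lambda>f. v (\<lambda>x. f (g \<otimes>\<^bsub>G\<^esub> x))) = m p u v \<and>
        m (p \<otimes>\<^bsub>G\<^esub> g) (\<lambda>f. u (\<lambda>x. f (x \<otimes>\<^bsub>G\<^esub> g))) (\<lambda>f. v (\<lambda>x. f (x \<otimes>\<^bsub>G\<^esub> g))) = m p u v)"

definition lie_algebra ::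
  "'a::{t2_space,second_countable_topology} monoid \<Rightarrow> ('a, 'e::euclidean_space) atlas \<Rightarrow>
   'a vfield set" where
  "lie_algebra G A = {V \<in> vector_fields A.
     \<forall>g. \<forall>f\<in>smooth_functions A. V (\<lambda>x. f (g \<otimes>\<^bsub>G\<^esub> x)) = (\<lambda>x. V f (g \<otimes>\<^bsub>G\<^esub> x))}"

text \<open>
  For a left-invariant metric and left-invariant fields, \<open>\<langle>V, W\<rangle>\<close> is a constant function on the
  group, so it may be evaluated at the identity.
\<close>

definition ip ::
  "'a monoid \<Rightarrow> ('a \<Rightarrow> 'a tvec \<Rightarrow> 'a tvec \<Rightarrow> real) \<Rightarrow> 'a vfield \<Rightarrow> 'a vfield \<Rightarrow> real" where
  "ip G m V W = m \<one>\<^bsub>G\<^esub> (\<lambda>f. V f \<one>\<^bsub>G\<^esub>) (\<lambda>f. W f \<one>\<^bsub>G\<^esub>)"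

definition lincomb :: "(3 \<Rightarrow> 'a vfield) \<Rightarrow> real^3 \<Rightarrow> 'a vfield" where
  "lincomb X w = (\<lambda>f p. \<Sum>i\<in>UNIV. w $ i * X i f p)"

definition orthonormal_basis ::
  "'a::{t2_space,second_countable_topology} monoid \<Rightarrow> ('a, 'e::euclidean_space) atlas \<Rightarrow>
   ('a \<Rightarrow> 'a tvec \<Rightarrow> 'a tvec \<Rightarrow> real) \<Rightarrow> (3 \<Rightarrow> 'a vfield) \<Rightarrow> bool" where
  "orthonormal_basis G A m X \<longleftrightarrow>
     (\<forall>i. X i \<in> lie_algebra G A) \<and>
     (\<forall>i j. ip G m (X i) (X j) = (if i = j then 1 else 0)) \<and>
     (\<forall>V\<in>lie_algebra G A. \<exists>w. V = lincomb X w)"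


section \<open>Fields along a curve\<close>

text \<open>
  A field \<open>\<Sum>i. w\<^sub>i X\<^sub>i\<close> along a curve is a function \<open>W\<close> from the parameter interval to the Lie
  algebra, with \<open>w\<^sub>i = \<langle>W, X\<^sub>i\<rangle>\<close>; its value at \<open>s\<close> as a tangent vector of the group is the value
  of the left-invariant field \<open>W s\<close> at \<open>\<alpha> s\<close>. The same representation serves curves in the
  Euclidean space formed by the Lie algebra.
\<close>

definition coords ::
  "'a monoid \<Rightarrow> ('a \<Rightarrow> 'a tvec \<Rightarrow> 'a tvec \<Rightarrow> real) \<Rightarrow> (3 \<Rightarrow> 'a vfield) \<Rightarrow> 'a vfield \<Rightarrow> real^3" where
  "coords G m X V = (\<chi> i. ip G m V (X i))"

definition smooth_field ::
  "'a::{t2_space,second_countable_topology} monoid \<Rightarrow> ('a, 'e::euclidean_space) atlas \<Rightarrow>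
   ('a \<Rightarrow> 'a tvec \<Rightarrow> 'a tvec \<Rightarrow> real) \<Rightarrow> (3 \<Rightarrow> 'a vfield) \<Rightarrow> real set \<Rightarrow> (real \<Rightarrow> 'a vfield) \<Rightarrow> bool" where
  "smooth_field G A m X I W \<longleftrightarrow>
     (\<forall>s\<in>I. W s \<in> lie_algebra G A) \<and> smooth_on (\<lambda>s. coords G m X (W s)) I"

definition dot ::
  "'a monoid \<Rightarrow> ('a \<Rightarrow> 'a tvec \<Rightarrow> 'a tvec \<Rightarrow> real) \<Rightarrow> (3 \<Rightarrow> 'a vfield) \<Rightarrow> real set \<Rightarrow>
   (real \<Rightarrow> 'a vfield) \<Rightarrow> real \<Rightarrow> 'a vfield" where
  "dot G m X I W s = lincomb X (vector_derivative (\<lambda>s. coords G m X (W s)) (at s within I))"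

text \<open>
  Covariant derivative of \<open>W\<close> along a curve with velocity field \<open>T\<close>. On left-invariant fields the
  Levi-Civita connection of a bi-invariant metric is \<open>D\<^sub>V W = 1/2 [V, W]\<close>, and the bilinear
  extension of the bracket over functions of \<open>s\<close> has the value \<open>[T s, W s]\<close> at \<open>s\<close>.
\<close>

definition cov_deriv ::
  "'a monoid \<Rightarrow> ('a \<Rightarrow> 'a tvec \<Rightarrow> 'a tvec \<Rightarrow> real) \<Rightarrow> (3 \<Rightarrow> 'a vfield) \<Rightarrow> real set \<Rightarrow>
   (real \<Rightarrow> 'a vfield) \<Rightarrow> (real \<Rightarrow> 'a vfield) \<Rightarrow> real \<Rightarrow> 'a vfield" where
  "cov_deriv G m X I T W s = (\<lambda>f p. dot G m X I W s f p + 1/2 * bracket (T s) (W s) f p)"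

text \<open>The orientation of the Lie algebra is the one for which the basis \<open>X\<close> is positive.\<close>

definition cross_prod ::
  "'a monoid \<Rightarrow> ('a \<Rightarrow> 'a tvec \<Rightarrow> 'a tvec \<Rightarrow> real) \<Rightarrow> (3 \<Rightarrow> 'a vfield) \<Rightarrow>
   'a vfield \<Rightarrow> 'a vfield \<Rightarrow> 'a vfield" where
  "cross_prod G m X V W = lincomb X (cross3 (coords G m X V) (coords G m X W))"


section \<open>Curves in the group and their Frenet apparatus\<close>

definition velocity ::
  "('a::topological_space, 'e::euclidean_space) atlas \<Rightarrow> real set \<Rightarrow> (real \<Rightarrow> 'a) \<Rightarrow> real \<Rightarrow> 'a tvec"
  where
  "velocity A I \<alpha> s =
     (\<lambda>f. if f \<in> smooth_functions A then vector_derivative (f \<circ> \<alpha>) (at s within I) else 0)"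

definition unit_speed_curve ::
  "('a::topological_space, 'e::euclidean_space) atlas \<Rightarrow> ('a \<Rightarrow> 'a tvec \<Rightarrow> 'a tvec \<Rightarrow> real) \<Rightarrow>
   real set \<Rightarrow> (real \<Rightarrow> 'a) \<Rightarrow> bool" where
  "unit_speed_curve A m I \<alpha> \<longleftrightarrow>
     is_interval I \<and> interior I \<noteq> {} \<and>
     smooth_map_on I euclidean_atlas A \<alpha> \<and>
     (\<forall>s\<in>I. sqrt (m (\<alpha> s) (velocity A I \<alpha> s) (velocity A I \<alpha> s)) = 1)"

definition frenet_apparatus ::
  "'a::{t2_space,second_countable_topology} monoid \<Rightarrow> ('a, 'e::euclidean_space) atlas \<Rightarrow>
   ('a \<Rightarrow> 'a tvec \<Rightarrow> 'a tvec \<Rightarrow> real) \<Rightarrow> (3 \<Rightarrow> 'a vfield) \<Rightarrow> real set \<Rightarrow> (real \<Rightarrow> 'a) \<Rightarrow>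
   (real \<Rightarrow> 'a vfield) \<Rightarrow> (real \<Rightarrow> 'a vfield) \<Rightarrow> (real \<Rightarrow> 'a vfield) \<Rightarrow>
   (real \<Rightarrow> real) \<Rightarrow> (real \<Rightarrow> real) \<Rightarrow> bool" where
  "frenet_apparatus G A m X I \<alpha> T N B \<kappa> \<tau> \<longleftrightarrow>
     smooth_field G A m X I T \<and> smooth_field G A m X I N \<and> smooth_field G A m X I B \<and>
     (\<forall>s\<in>I.
        (\<lambda>f. T s f (\<alpha> s)) = velocity A I \<alpha> s \<and>
        ip G m (T s) (T s) = 1 \<and> ip G m (N s) (N s) = 1 \<and> ip G m (B s) (B s) = 1 \<and>
        ip G m (T s) (N s) = 0 \<and> ip G m (T s) (B s) = 0 \<and> ip G m (N s) (B s) = 0 \<and>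
        B s = cross_prod G m X (T s) (N s) \<and>
        \<kappa> s = sqrt (ip G m (dot G m X I T s) (dot G m X I T s)) \<and> \<kappa> s > 0 \<and>
        cov_deriv G m X I T T s = (\<lambda>f p. \<kappa> s * N s f p) \<and>
        cov_deriv G m X I T N s = (\<lambda>f p. - \<kappa> s * T s f p + \<tau> s * B s f p) \<and>
        cov_deriv G m X I T B s = (\<lambda>f p. - \<tau> s * N s f p))"


section \<open>Tangent indicatrix, slant helices and general helices\<close>

text \<open>
  \<open>\<sigma>\<close> is an arc length function of the curve \<open>T\<close> in the Lie algebra (determined up to an additive
  constant), and \<open>\<beta>\<close>, with parameter interval \<open>\<sigma> ` I\<close>, is \<open>T\<close> as a function of \<open>\<sigma>\<close>.
\<close>

definition tangent_indicatrix ::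
  "'a monoid \<Rightarrow> ('a \<Rightarrow> 'a tvec \<Rightarrow> 'a tvec \<Rightarrow> real) \<Rightarrow> (3 \<Rightarrow> 'a vfield) \<Rightarrow> real set \<Rightarrow>
   (real \<Rightarrow> 'a vfield) \<Rightarrow> (real \<Rightarrow> real) \<Rightarrow> (real \<Rightarrow> 'a vfield) \<Rightarrow> bool" where
  "tangent_indicatrix G m X I T \<sigma> \<beta> \<longleftrightarrow>
     (\<forall>a\<in>I. \<forall>b\<in>I. a \<le> b \<longrightarrow>
        ((\<lambda>s. sqrt (ip G m (dot G m X I T s) (dot G m X I T s))) has_integral (\<sigma> b - \<sigma> a)) {a..b}) \<and>
     (\<forall>s\<in>I. \<beta> (\<sigma> s) = T s)"

text \<open>
  Angles lie in \<open>[0, \<pi>]\<close>. The right angle is excluded for slant helices and for general helices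
  alike: with it admitted only for general helices, a circular helix in Euclidean space, whose
  tangent indicatrix is a circle, would not be a slant helix while its indicatrix would be a
  general helix.
\<close>

definition slant_helix ::
  "'a::{t2_space,second_countable_topology} monoid \<Rightarrow> ('a, 'e::euclidean_space) atlas \<Rightarrow>
   ('a \<Rightarrow> 'a tvec \<Rightarrow> 'a tvec \<Rightarrow> real) \<Rightarrow> real set \<Rightarrow> (real \<Rightarrow> 'a vfield) \<Rightarrow> bool" where
  "slant_helix G A m I N \<longleftrightarrow>
     (\<exists>V\<in>lie_algebra G A. \<exists>\<theta>\<in>{0..pi}. ip G m V V = 1 \<and> \<theta> \<noteq> pi / 2 \<and>
        (\<forall>s\<in>I. ip G m (N s) V = cos \<theta>))"

text \<open>For a unit speed curve \<open>\<beta>\<close> in the Lie algebra, so that the unit tangent is \<open>dot \<beta>\<close>.\<close>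

definition general_helix ::
  "'a::{t2_space,second_countable_topology} monoid \<Rightarrow> ('a, 'e::euclidean_space) atlas \<Rightarrow>
   ('a \<Rightarrow> 'a tvec \<Rightarrow> 'a tvec \<Rightarrow> real) \<Rightarrow> (3 \<Rightarrow> 'a vfield) \<Rightarrow> real set \<Rightarrow> (real \<Rightarrow> 'a vfield) \<Rightarrow> bool" where
  "general_helix G A m X J \<beta> \<longleftrightarrow>
     (\<exists>V\<in>lie_algebra G A. \<exists>\<theta>\<in>{0..pi}. ip G m V V = 1 \<and> \<theta> \<noteq> pi / 2 \<and>
        (\<forall>r\<in>J. ip G m (dot G m X J \<beta> r) V = cos \<theta>))"

end

theory Submission
  imports Defs
begin

text \<open>
  The tangent indicatrix has the principal normal of \<open>\<alpha>\<close> as its unit tangent: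
  \<open>d\<beta>/ds\<^sup>* = N\<close> at corresponding parameters. Indeed \<open>[T, T] = 0\<close>, so the bracket term of the
  covariant derivative disappears from \<open>D\<^sub>T T = \<kappa> N\<close> and \<open>\<kappa> N\<close> is the plain coordinate
  derivative of \<open>T\<close>. By definition \<open>\<kappa>\<close> is the length of that derivative, that is, the
  speed of the curve \<open>T\<close> in the Lie algebra, and dividing by the speed is what passing to arc length does to a derivative
  (\<open>arc_length_has_vector_derivative\<close>). This is \<open>dot_tangent_indicatrix\<close>. The conditions that
  define a slant helix \<open>\<alpha>\<close> and a general helix \<open>\<beta>\<close> are then the same condition, for the same
  fixed vector and the same angle.
\<close>

section \<open>Reparametrization by arc length\<close>

text \<open>
  The interval may be closed at either end, so the derivatives are one-sided there and the
  fundamental theorem of calculus is needed relative to \<open>I\<close>. The bound on the increment is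
  that of the integral of \<open>v - v s\<close> over the segment between \<open>s\<close> and \<open>y\<close>, which stays in \<open>I\<close>.
\<close>

lemma has_vector_derivative_of_integral_increments:
  fixes v \<sigma> :: "real \<Rightarrow> real"
  assumes "is_interval I" and cont: "continuous_on I v" and s: "s \<in> I"
    and int: "\<And>a b. a \<in> I \<Longrightarrow> b \<in> I \<Longrightarrow> a \<le> b \<Longrightarrow> (v has_integral (\<sigma> b - \<sigma> a)) {a..b}"
  shows "(\<sigma> has_vector_derivative v s) (at s within I)"
proof -
  have sub: "{a..b} \<subseteq> I" if "a \<in> I" "b \<in> I" for a b
    using connected_contains_Icc[OF is_interval_connected[OF assms(1)]] that by blast
  have bound: "\<bar>\<sigma> b - \<sigma> a - (b - a) * v s\<bar> \<le> e * (b - a)"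
    if "a \<in> I" "b \<in> I" "a \<le> b" "0 < e" "\<And>x. x \<in> {a..b} \<Longrightarrow> \<bar>v x - v s\<bar> \<le> e" for a b e
  proof -
    have "((\<lambda>x. v x - v s) has_integral (\<sigma> b - \<sigma> a - (b - a) * v s)) {a..b}"
      using has_integral_diff[OF int[OF that(1-3)] has_integral_const_real[of "v s" a b]] that(3)
      by simp
    then have "norm (\<sigma> b - \<sigma> a - (b - a) * v s) \<le> e * measure lborel {a..b}"
      by (rule has_integral_bound_real[where S = "{}", rotated 2]) (use that in auto)
    with that(3) show ?thesis by simp
  qed
  have "\<exists>d>0. \<forall>y\<in>I. norm (y - s) < d \<longrightarrow>
      norm (\<sigma> y - \<sigma> s - (y - s) *\<^sub>R v s) \<le> e * norm (y - s)" if "0 < e" for e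
  proof -
    obtain d where "0 < d" and d: "\<And>x. x \<in> I \<Longrightarrow> \<bar>x - s\<bar> < d \<Longrightarrow> \<bar>v x - v s\<bar> \<le> e"
    proof -
      from cont s \<open>0 < e\<close>
      obtain d where "0 < d" "\<forall>x\<in>I. dist x s < d \<longrightarrow> dist (v x) (v s) < e"
        unfolding continuous_on_iff by blast
      then show thesis
        by (intro that[of d]) (force simp: dist_real_def intro: less_imp_le)+
    qed
    have "\<bar>\<sigma> y - \<sigma> s - (y - s) * v s\<bar> \<le> e * \<bar>y - s\<bar>" if y: "y \<in> I" "\<bar>y - s\<bar> < d" for y
    proof (cases "s \<le> y")
      case True
      have "\<bar>v x - v s\<bar> \<le> e" if "x \<in> {s..y}" for x
        using d[of x] sub[OF s y(1)] y that by auto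
      from bound[OF s y(1) True \<open>0 < e\<close> this] True show ?thesis by simp
    next
      case False
      then have "y \<le> s" by simp
      have "\<bar>v x - v s\<bar> \<le> e" if "x \<in> {y..s}" for x
        using d[of x] sub[OF y(1) s] y that by auto
      from bound[OF y(1) s \<open>y \<le> s\<close> \<open>0 < e\<close> this]
      have "\<bar>\<sigma> s - \<sigma> y - (s - y) * v s\<bar> \<le> e * (s - y)" .
      moreover have "\<bar>\<sigma> y - \<sigma> s - (y - s) * v s\<bar> = \<bar>\<sigma> s - \<sigma> y - (s - y) * v s\<bar>"
        by (subst abs_minus_cancel[symmetric]) (simp add: algebra_simps)
      moreover have "\<bar>y - s\<bar> = s - y"
        using \<open>y \<le> s\<close> by simp
      ultimately show ?thesis by simp
    qed
    with \<open>0 < d\<close> show ?thesis by auto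
  qed
  then show ?thesis
    unfolding has_vector_derivative_def has_derivative_within_alt
    by (auto intro: bounded_linear_mult_left)
qed

text \<open>
  If \<open>\<sigma> a = \<sigma> b\<close> with \<open>a < b\<close>, then the positive continuous function \<open>v\<close> has integral 0 over
  \<open>{a..b}\<close> and so vanishes there.
\<close>

lemma arc_length_inj_on:
  fixes v \<sigma> :: "real \<Rightarrow> real"
  assumes "is_interval I" and cont: "continuous_on I v" and pos: "\<And>s. s \<in> I \<Longrightarrow> 0 < v s"
    and int: "\<And>a b. a \<in> I \<Longrightarrow> b \<in> I \<Longrightarrow> a \<le> b \<Longrightarrow> (v has_integral (\<sigma> b - \<sigma> a)) {a..b}"
  shows "inj_on \<sigma> I"
proof (rule linorder_inj_onI)
  fix a b :: real
  assume ab: "a < b" "a \<in> I" "b \<in> I"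
  then have sub: "{a..b} \<subseteq> I"
    using connected_contains_Icc[OF is_interval_connected[OF assms(1)]] by blast
  show "\<sigma> a \<noteq> \<sigma> b"
  proof
    assume "\<sigma> a = \<sigma> b"
    then have "(v has_integral 0) (cbox a b)"
      using int[of a b] ab by simp
    moreover have "continuous_on (cbox a b) v"
      using continuous_on_subset[OF cont sub] by simp
    moreover have "0 \<le> v x" if "x \<in> box a b" for x
    proof -
      have "x \<in> I"
        using sub that by (auto simp: subset_iff)
      then show ?thesis by (rule less_imp_le[OF pos])
    qed
    moreover have "box a b \<noteq> {}" "a \<in> cbox a b"
      using ab by auto
    ultimately have "v a = 0"
      by (metis has_integral_0_cbox_imp_0)
    with pos[OF ab(2)] show False by simp
  qed
qed auto

text \<open>
  Only the values of \<open>\<gamma>\<close> at \<open>\<sigma> s\<close> are prescribed, so \<open>\<gamma> = c \<circ> \<sigma>\<^sup>-\<^sup>1\<close> has to be recovered first. A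
  continuous injection of an interval into the line is a homeomorphism onto its image, which
  gives the continuity of \<open>\<sigma>\<^sup>-\<^sup>1\<close> that the inverse rule for derivatives within a set asks for.
  The chain rule then applies.
\<close>

lemma arc_length_has_vector_derivative:
  fixes c c' \<gamma> :: "real \<Rightarrow> 'b::real_normed_vector" and \<sigma> :: "real \<Rightarrow> real"
  assumes I: "is_interval I" and s: "s \<in> I"
    and c: "\<And>s. s \<in> I \<Longrightarrow> (c has_vector_derivative c' s) (at s within I)"
    and cont: "continuous_on I c'" and reg: "\<And>s. s \<in> I \<Longrightarrow> c' s \<noteq> 0"
    and int: "\<And>a b. a \<in> I \<Longrightarrow> b \<in> I \<Longrightarrow> a \<le> b \<Longrightarrow>
      ((\<lambda>s. norm (c' s)) has_integral (\<sigma> b - \<sigma> a)) {a..b}"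
    and \<gamma>: "\<And>s. s \<in> I \<Longrightarrow> \<gamma> (\<sigma> s) = c s"
  shows "(\<gamma> has_vector_derivative (1 / norm (c' s)) *\<^sub>R c' s) (at (\<sigma> s) within \<sigma> ` I)"
proof -
  have contv: "continuous_on I (\<lambda>s. norm (c' s))"
    by (intro continuous_intros cont)
  have \<sigma>': "(\<sigma> has_vector_derivative norm (c' s)) (at s within I)" if "s \<in> I" for s
    using has_vector_derivative_of_integral_increments[OF I contv that int] .
  have "continuous_on I \<sigma>"
    using \<sigma>' by (meson has_vector_derivative_continuous continuous_on_eq_continuous_within)
  moreover have "inj_on \<sigma> I"
    by (rule arc_length_inj_on[OF I contv _ int]) (use reg in auto)
  moreover have "path_connected I"
    by (rule is_interval_path_connected[OF I])
  ultimately obtain g where g: "homeomorphism I (\<sigma> ` I) \<sigma> g"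
    using injective_into_1d_eq_homeomorphism by blast
  have "(g has_derivative (\<lambda>h. h * (1 / norm (c' s)))) (at (\<sigma> s) within \<sigma> ` I)"
  proof (rule has_derivative_inverse_within)
    show "(\<sigma> has_derivative (\<lambda>h. h * norm (c' s))) (at s within I)"
      using \<sigma>'[OF s] by (simp add: has_vector_derivative_def)
    show "continuous (at (\<sigma> s) within \<sigma> ` I) g"
      using g s by (auto simp: homeomorphism_def continuous_on_eq_continuous_within)
    show "(\<lambda>h. h * (1 / norm (c' s))) \<circ> (\<lambda>h. h * norm (c' s)) = id"
      using reg[OF s] by (auto simp: fun_eq_iff)
    show "linear (\<lambda>h::real. h * (1 / norm (c' s)))"
      by (intro bounded_linear.linear bounded_linear_mult_left)
    show "g (\<sigma> x) = x" if "x \<in> I" for x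
      using g that by (simp add: homeomorphism_def)
  qed (rule s)
  then have "(g has_vector_derivative 1 / norm (c' s)) (at (\<sigma> s) within \<sigma> ` I)"
    by (simp add: has_vector_derivative_def)
  moreover have "g ` \<sigma> ` I = I" "g (\<sigma> s) = s"
    using g s by (auto simp: homeomorphism_def)
  ultimately have "((c \<circ> g) has_vector_derivative (1 / norm (c' s)) *\<^sub>R c' s)
      (at (\<sigma> s) within \<sigma> ` I)"
    by (intro vector_diff_chain_within) (use c[OF s] in auto)
  moreover have "\<gamma> r = (c \<circ> g) r" if "r \<in> \<sigma> ` I" for r
    using that g \<gamma> by (auto simp: homeomorphism_def)
  ultimately show ?thesis
    using has_vector_derivative_transform[OF imageI[OF s]] by blast
qed

text \<open>On the line a Frechet derivative is determined by its value at 1.\<close>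

lemma smooth_on_imp_C1:
  fixes c :: "real \<Rightarrow> 'b::real_normed_vector"
  assumes "smooth_on c I"
  obtains c' where "\<And>s. s \<in> I \<Longrightarrow> (c has_vector_derivative c' s) (at s within I)"
    and "continuous_on I c'"
proof -
  have "Ck_on (Suc 0) c I"
    using assms by (simp add: smooth_on_def del: Ck_on.simps)
  then obtain D where D: "\<And>s. s \<in> I \<Longrightarrow> (c has_derivative D s) (at s within I)"
      "continuous_on I (\<lambda>s. D s 1)"
    unfolding Ck_on.simps by metis
  have "(c has_vector_derivative D s 1) (at s within I)" if "s \<in> I" for s
  proof -
    have "h *\<^sub>R D s 1 = D s h" for h
      using linear_cmul[OF has_derivative_linear[OF D(1)[OF that]], of h 1] by simp
    then have "(\<lambda>h. h *\<^sub>R D s 1) = D s"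
      by (rule ext)
    with D(1)[OF that] show ?thesis by (simp only: has_vector_derivative_def)
  qed
  with D(2) show thesis by (rule that[rotated])
qed

section \<open>The Lie algebra as a Euclidean space\<close>

text \<open>
  Bilinearity of a metric is postulated only for derivations. To expand the inner product of
  linear combinations one therefore checks along the way that partial sums stay derivations.
\<close>

lemma tangent_space_zero: "(\<lambda>f. 0) \<in> tangent_space A p"
  by (simp add: tangent_space_def)

lemma tangent_space_lincomb:
  assumes "u \<in> tangent_space A p" "v \<in> tangent_space A p"
  shows "(\<lambda>f. a * u f + b * v f) \<in> tangent_space A p"
  using assms by (auto simp: tangent_space_def algebra_simps)

lemma tangent_space_scaled_sum:
  assumes "finite S" "\<And>i. i \<in> S \<Longrightarrow> u i \<in> tangent_space A p"
  shows "(\<lambda>f. \<Sum>i\<in>S. w i * u i f) \<in> tangent_space A p"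
  using assms
proof (induction S rule: finite_induct)
  case empty
  then show ?case by (simp add: tangent_space_zero)
next
  case (insert i S)
  then show ?case
    using tangent_space_lincomb[of "u i" A p "\<lambda>f. \<Sum>i\<in>S. w i * u i f" "w i" 1] by simp
qed

lemma riemannian_metric_linear_left:
  assumes "riemannian_metric A m"
    and "u \<in> tangent_space A p" "v \<in> tangent_space A p" "x \<in> tangent_space A p"
  shows "m p (\<lambda>f. a * u f + b * v f) x = a * m p u x + b * m p v x"
  using assms(1)[unfolded riemannian_metric_def, THEN conjunct1, THEN spec[of _ p],
    THEN bspec, OF assms(2), THEN bspec, OF assms(3), THEN bspec, OF assms(4)]
  by simp

lemma riemannian_metric_sym:
  assumes "riemannian_metric A m" "u \<in> tangent_space A p" "v \<in> tangent_space A p"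
  shows "m p u v = m p v u"
  using assms(1)[unfolded riemannian_metric_def, THEN conjunct1, THEN spec[of _ p],
    THEN bspec, OF assms(2), THEN bspec, OF assms(3), THEN bspec, OF assms(3)]
  by simp

lemma riemannian_metric_scaled_sum_left:
  assumes m: "riemannian_metric A m" and x: "x \<in> tangent_space A p"
    and "finite S" "\<And>i. i \<in> S \<Longrightarrow> u i \<in> tangent_space A p"
  shows "m p (\<lambda>f. \<Sum>i\<in>S. w i * u i f) x = (\<Sum>i\<in>S. w i * m p (u i) x)"
  using assms(3,4)
proof (induction S rule: finite_induct)
  case empty
  have "m p (\<lambda>f. 0 * x f + 0 * x f) x = 0 * m p x x + 0 * m p x x"
    by (rule riemannian_metric_linear_left[OF m x x x])
  then show ?case by simp
next
  case (insert i S)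
  have "m p (\<lambda>f. w i * u i f + 1 * (\<Sum>i\<in>S. w i * u i f)) x
      = w i * m p (u i) x + 1 * m p (\<lambda>f. \<Sum>i\<in>S. w i * u i f) x"
    using insert.prems
    by (intro riemannian_metric_linear_left[OF m _ _ x] tangent_space_scaled_sum insert.hyps(1))
      auto
  with insert show ?case by simp
qed

text \<open>
  By this lemma and the next one, \<open>lincomb X\<close> identifies \<open>\<real>\<^sup>3\<close> isometrically with the Lie
  algebra, and lengths of derivatives of fields can be computed in coordinates.
\<close>

lemma coords_lincomb:
  fixes G :: "'a::{t2_space,second_countable_topology} monoid"
  assumes "riemannian_metric A m" and X: "orthonormal_basis G A m X"
  shows "coords G m X (lincomb X w) = w"
proof -
  let ?u = "\<lambda>i f. X i f \<one>\<^bsub>G\<^esub>"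
  have u: "?u i \<in> tangent_space A \<one>\<^bsub>G\<^esub>" for i
    using X by (auto simp: orthonormal_basis_def lie_algebra_def vector_fields_def)
  have "ip G m (lincomb X w) (X j) = (\<Sum>i\<in>UNIV. w $ i * ip G m (X i) (X j))" for j
    unfolding ip_def lincomb_def
    by (rule riemannian_metric_scaled_sum_left[OF assms(1) u]) (auto intro: u)
  also have "\<dots> j = w $ j" for j
    using X by (simp add: orthonormal_basis_def if_distrib[of "(*) _"] cong: if_cong)
  finally show ?thesis by (simp add: coords_def vec_eq_iff)
qed

lemma ip_lincomb:
  fixes G :: "'a::{t2_space,second_countable_topology} monoid"
  assumes "riemannian_metric A m" and X: "orthonormal_basis G A m X"
  shows "ip G m (lincomb X v) (lincomb X w) = v \<bullet> w"
proof -
  let ?u = "\<lambda>i f. X i f \<one>\<^bsub>G\<^esub>"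
  have u: "?u i \<in> tangent_space A \<one>\<^bsub>G\<^esub>" for i
    using X by (auto simp: orthonormal_basis_def lie_algebra_def vector_fields_def)
  have w: "(\<lambda>f. lincomb X w f \<one>\<^bsub>G\<^esub>) \<in> tangent_space A \<one>\<^bsub>G\<^esub>"
    unfolding lincomb_def by (rule tangent_space_scaled_sum) (auto intro: u)
  have coeff: "ip G m (X i) (lincomb X w) = w $ i" for i
  proof -
    have "ip G m (X i) (lincomb X w) = ip G m (lincomb X w) (X i)"
      unfolding ip_def by (rule riemannian_metric_sym[OF assms(1) u w])
    also have "\<dots> = coords G m X (lincomb X w) $ i"
      by (simp add: coords_def)
    finally show ?thesis by (simp add: coords_lincomb[OF assms])
  qed
  have "ip G m (lincomb X v) (lincomb X w) = (\<Sum>i\<in>UNIV. v $ i * ip G m (X i) (lincomb X w))"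
    unfolding ip_def lincomb_def[of X v]
    by (rule riemannian_metric_scaled_sum_left[OF assms(1) w]) (auto intro: u)
  then show ?thesis by (simp add: coeff inner_vec_def)
qed

section \<open>The unit tangent of the tangent indicatrix\<close>

text \<open>The first Frenet equation, in which the bracket \<open>[T, T]\<close> cancels.\<close>

lemma dot_unit_tangent:
  assumes "frenet_apparatus G A m X I \<alpha> T N B \<kappa> \<tau>" and "s \<in> I"
  shows "dot G m X I T s = (\<lambda>f p. \<kappa> s * N s f p)"
proof -
  have "cov_deriv G m X I T T s = (\<lambda>f p. \<kappa> s * N s f p)"
    using assms unfolding frenet_apparatus_def by blast
  then show ?thesis by (simp add: cov_deriv_def bracket_def)
qed

text \<open>
  The unit tangent of \<open>\<beta>\<close> is \<open>N\<close>. The chain rule provides some vector derivative of \<open>\<beta>\<close> within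
  \<open>\<sigma> ` I\<close>; that \<open>vector_derivative\<close> returns it rests on uniqueness, which holds because both
  \<open>I\<close> and \<open>\<sigma> ` I\<close> are connected sets with more than one point and so have no isolated points.
\<close>

lemma dot_tangent_indicatrix:
  fixes G :: "'a::{t2_space,second_countable_topology} monoid"
  assumes m: "riemannian_metric A m" and X: "orthonormal_basis G A m X"
    and I: "is_interval I" "interior I \<noteq> {}"
    and F: "frenet_apparatus G A m X I \<alpha> T N B \<kappa> \<tau>"
    and \<beta>: "tangent_indicatrix G m X I T \<sigma> \<beta>"
    and s: "s \<in> I"
  shows "dot G m X (\<sigma> ` I) \<beta> (\<sigma> s) = N s"
proof -
  have "smooth_on (\<lambda>s. coords G m X (T s)) I"
    using F by (simp add: frenet_apparatus_def smooth_field_def)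
  then obtain t' where t': "\<And>s. s \<in> I \<Longrightarrow>
      ((\<lambda>s. coords G m X (T s)) has_vector_derivative t' s) (at s within I)"
    and cont: "continuous_on I t'"
    by (rule smooth_on_imp_C1) blast
  have two_points: "I \<noteq> {x}" for x
    using I(2) by auto
  have "s islimpt I" if "s \<in> I" for s
    using connected_imp_perfect[OF _ that two_points] I(1) is_interval_connected by blast
  then have dotT: "dot G m X I T s = lincomb X (t' s)" if "s \<in> I" for s
    using vector_derivative_within[OF _ t'[OF that]] that
    by (simp add: dot_def trivial_limit_within)
  have speed: "sqrt (ip G m (dot G m X I T s) (dot G m X I T s)) = norm (t' s)" if "s \<in> I" for s
    by (simp add: dotT[OF that] ip_lincomb[OF m X] norm_eq_sqrt_inner)
  have \<kappa>: "\<kappa> s = norm (t' s)" "\<kappa> s > 0" if "s \<in> I" for s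
    using F that speed[OF that] by (auto simp: frenet_apparatus_def)
  have int: "((\<lambda>s. norm (t' s)) has_integral (\<sigma> b - \<sigma> a)) {a..b}"
    if "a \<in> I" "b \<in> I" "a \<le> b" for a b
  proof -
    have "{a..b} \<subseteq> I"
      using connected_contains_Icc[OF is_interval_connected[OF I(1)]] that by blast
    moreover have "((\<lambda>s. sqrt (ip G m (dot G m X I T s) (dot G m X I T s)))
        has_integral (\<sigma> b - \<sigma> a)) {a..b}"
      using \<beta> that by (auto simp: tangent_indicatrix_def)
    ultimately show ?thesis
      by (subst has_integral_cong[OF speed[symmetric]]) auto
  qed
  have \<beta>': "((\<lambda>r. coords G m X (\<beta> r)) has_vector_derivative (1 / norm (t' s)) *\<^sub>R t' s)
      (at (\<sigma> s) within \<sigma> ` I)" if "s \<in> I" for s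
  proof (rule arc_length_has_vector_derivative[OF I(1) that t' cont _ int])
    show "t' s \<noteq> 0" if "s \<in> I" for s
      using \<kappa>[OF that] by auto
    show "coords G m X (\<beta> (\<sigma> s)) = coords G m X (T s)" if "s \<in> I" for s
      using \<beta> that by (simp add: tangent_indicatrix_def)
  qed
  have contv: "continuous_on I (\<lambda>s. norm (t' s))"
    by (intro continuous_intros cont)
  have "inj_on \<sigma> I"
    by (rule arc_length_inj_on[OF I(1) contv _ int]) (simp_all flip: \<kappa>(1) add: \<kappa>(2))
  have "continuous_on I \<sigma>"
    using has_vector_derivative_of_integral_increments[OF I(1) contv _ int]
    by (meson has_vector_derivative_continuous continuous_on_eq_continuous_within)
  then have "connected (\<sigma> ` I)"
    using I(1) by (auto intro: connected_continuous_image is_interval_connected)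
  moreover have "\<sigma> ` I \<noteq> {x}" for x
  proof
    assume "\<sigma> ` I = {x}"
    then have "\<sigma> y = \<sigma> s" if "y \<in> I" for y
      using that s by (metis imageI singletonD)
    then have "y = s" if "y \<in> I" for y
      using inj_onD[OF \<open>inj_on \<sigma> I\<close> _ that s] that by blast
    then have "I = {s}"
      using s by blast
    with two_points show False by blast
  qed
  ultimately have "\<sigma> s islimpt \<sigma> ` I"
    using s by (intro connected_imp_perfect) auto
  then have "dot G m X (\<sigma> ` I) \<beta> (\<sigma> s) = lincomb X ((1 / norm (t' s)) *\<^sub>R t' s)"
    using vector_derivative_within[OF _ \<beta>'[OF s]] by (simp add: dot_def trivial_limit_within)
  also have "\<dots> = (\<lambda>f p. 1 / \<kappa> s * dot G m X I T s f p)"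
    by (simp add: dotT[OF s] \<kappa>(1)[OF s] lincomb_def sum_divide_distrib)
  also have "\<dots> = N s"
    using dot_unit_tangent[OF F s] \<kappa>(2)[OF s] by auto
  finally show ?thesis .
qed

theorem theorem4p2:
  fixes G :: "'a::{t2_space,second_countable_topology} monoid"
    and A :: "('a, real^3) atlas"
    and m :: "'a \<Rightarrow> 'a tvec \<Rightarrow> 'a tvec \<Rightarrow> real"
    and X :: "3 \<Rightarrow> 'a vfield"
    and I :: "real set"
    and \<alpha> :: "real \<Rightarrow> 'a"
    and T N B :: "real \<Rightarrow> 'a vfield"
    and \<kappa> \<tau> \<sigma> :: "real \<Rightarrow> real"
    and \<beta> :: "real \<Rightarrow> 'a vfield"
  assumes "lie_group G A"
    and "bi_invariant_metric G A m"
    and "orthonormal_basis G A m X"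
    and "unit_speed_curve A m I \<alpha>"
    and "frenet_apparatus G A m X I \<alpha> T N B \<kappa> \<tau>"
    and "tangent_indicatrix G m X I T \<sigma> \<beta>"
  shows "slant_helix G A m I N \<longleftrightarrow> general_helix G A m X (\<sigma> ` I) \<beta>"
proof -
  have "riemannian_metric A m" "is_interval I" "interior I \<noteq> {}"
    using assms(2,4) by (auto simp: bi_invariant_metric_def unit_speed_curve_def)
  then have "dot G m X (\<sigma> ` I) \<beta> (\<sigma> s) = N s" if "s \<in> I" for s
    using dot_tangent_indicatrix assms(3,5,6) that by blast
  then show ?thesis
    by (simp add: slant_helix_def general_helix_def)
qed

end
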